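(* Let $(X_i,Y_i)$, $i=1,\dots,n$, be iid with $\Lambda_0(Y_i)=h_0(X_i)+\varepsilon_i$, where $\Lambda_0$ is strictly increasing and continuous. Assume: (1) $\varepsilon_1,\dots,\varepsilon_n$ are iid with cdf $F_0$, $F_0(0)=1$, $F_0(-\Delta)<1$ for all $\Delta>0$, and are independent of $X_1,\dots,X_n$; (2) $X_1,\dots,X_n$ are iid with cdf $F_X$ and density $f_X$ that is continuous and bounded away from zero on its support $[0,1]$; (3) $h_0$ is continuous on $[0,1]$; (4) $(b_n)$ is a sequence of positive numbers with $b_n\to0$ and $(\log n)/(nb_n)\to0$. Let $\tilde h_0(x)=\max\{\Lambda_0(Y_i): 1\le i\le n,\ |X_i-x|\le b_n\}$ for $x\in[0,1]$. Then $\|\tilde h_0-h_0\|_\infty=\sup_{x\in[0,1]}|\tilde h_0(x)-h_0(x)|=o_P(1)$ as $n\to\infty$.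
   Context: $o_P(1)$ denotes convergence to $0$ in (outer, if needed) probability. If no $i$ satisfies $|X_i-x|\le b_n$, set $\tilde h_0(x)=0$. *)

theory Defs
  imports "HOL-Probability.Probability"
begin

definition (in prob_space) iid :: "('i \<Rightarrow> 'a \<Rightarrow> 'b::topological_space) \<Rightarrow> 'i set \<Rightarrow> bool" where
  "iid Z I \<longleftrightarrow> indep_vars (\<lambda>_. borel) Z I \<and>
     (\<forall>i\<in>I. \<forall>j\<in>I. distr M borel (Z i) = distr M borel (Z j))"

text \<open>Convergence to 0 in outer probability: no measurability of \<open>Z n\<close> is required.
  For measurable \<open>Z n\<close> this is ordinary convergence to 0 in probability, since
  \<^const>\<open>outer_measure_of\<close> agrees with \<^const>\<open>emeasure\<close> on measurable sets.\<close>

definition (in prob_space) little_o_P_1 :: "(nat \<Rightarrow> 'a \<Rightarrow> real) \<Rightarrow> bool" where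
  "little_o_P_1 Z \<longleftrightarrow>
     (\<forall>e>0. (\<lambda>n. outer_measure_of M {\<omega>\<in>space M. \<bar>Z n \<omega>\<bar> > e}) \<longlonglongrightarrow> 0)"

definition h_tilde ::
    "(real \<Rightarrow> real) \<Rightarrow> (nat \<Rightarrow> 'a \<Rightarrow> real) \<Rightarrow> (nat \<Rightarrow> 'a \<Rightarrow> real) \<Rightarrow> (nat \<Rightarrow> real) \<Rightarrow>
     nat \<Rightarrow> 'a \<Rightarrow> real \<Rightarrow> real" where
  "h_tilde \<Lambda> X Y b n \<omega> x =
     (let I = {i\<in>{1..n}. \<bar>X i \<omega> - x\<bar> \<le> b n}
      in if I = {} then 0 else Max ((\<lambda>i. \<Lambda> (Y i \<omega>)) ` I))"

end

theory Submission
  imports Defs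
begin

text \<open>Cut \<open>[0,1]\<close> into \<open>m\<close> cells of length \<open>1 / m \<le> b n\<close>, with \<open>m\<close> of order \<open>1 / b n\<close>. Almost surely
  \<open>\<epsilon> i \<le> 0\<close>, so the local maximum cannot exceed \<open>h0 x\<close> by more than the modulus of continuity of \<open>h0\<close>;
  and it falls below \<open>h0 x\<close> by a fixed amount only if the cell containing \<open>x\<close> has no observation with
  \<open>\<epsilon> i > - \<Delta>\<close>. Each observation is of this kind with probability at least \<open>a / m\<close>, where \<open>a > 0\<close>
  depends only on \<open>\<Delta>\<close>, so some cell fails with probability at most \<open>m (1 - a / m) ^ n \<le> m exp (- a n / m)\<close>,
  which tends to \<open>0\<close> because \<open>ln n = o(n b n)\<close>.\<close>

text \<open>Independence turns the probability into a product, and each factor is at most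
  \<open>1 - p \<le> exp (- p)\<close>, an inequality valid for every real \<open>p\<close>. The
  sets \<open>S i\<close> may vary with \<open>i\<close>.\<close>

lemma (in prob_space) prob_all_avoid_le_exp:
  assumes "indep_vars N Z I" "finite I"
    and S: "\<And>i. i \<in> I \<Longrightarrow> S i \<in> sets (N i)"
    and p: "\<And>i. i \<in> I \<Longrightarrow> p \<le> prob {\<omega>\<in>space M. Z i \<omega> \<in> S i}"
  shows "prob {\<omega>\<in>space M. \<forall>i\<in>I. Z i \<omega> \<notin> S i} \<le> exp (- p * card I)"
proof (cases "I = {}")
  \<comment> \<open>\<open>indep_varsD\<close> speaks of nonempty index sets; here the bound is just
    \<open>exp 0 = 1\<close>.\<close>
  case True
  then show ?thesis by simp
next
  case False
  have rv: "random_variable (N i) (Z i)" if "i \<in> I" for i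
    using assms(1) that by (auto simp: indep_vars_def)
  have compl: "prob (Z i -` (space (N i) - S i) \<inter> space M) = 1 - prob {\<omega>\<in>space M. Z i \<omega> \<in> S i}"
    if "i \<in> I" for i
  proof -
    have "{\<omega>\<in>space M. Z i \<omega> \<in> S i} \<in> events"
      using measurable_sets[OF rv[OF that] S[OF that]]
      by (simp add: vimage_def Int_def conj_commute)
    moreover have "Z i -` (space (N i) - S i) \<inter> space M = space M - {\<omega>\<in>space M. Z i \<omega> \<in> S i}"
      using measurable_space[OF rv[OF that]] by auto
    ultimately show ?thesis by (simp add: prob_compl)
  qed
  have "{\<omega>\<in>space M. \<forall>i\<in>I. Z i \<omega> \<notin> S i} = (\<Inter>i\<in>I. Z i -` (space (N i) - S i) \<inter> space M)"
    using measurable_space[OF rv] False by auto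
  also have "prob \<dots> = (\<Prod>i\<in>I. prob (Z i -` (space (N i) - S i) \<inter> space M))"
    using assms False by (intro indep_varsD) auto
  also have "\<dots> \<le> (\<Prod>i\<in>I. exp (- p))"
  proof (intro prod_mono conjI)
    fix i assume i: "i \<in> I"
    show "prob (Z i -` (space (N i) - S i) \<inter> space M) \<le> exp (- p)"
      using compl[OF i] p[OF i] exp_ge_add_one_self[of "- p"] by linarith
  qed simp
  also have "\<dots> = exp (- p * card I)"
    by (simp add: exp_of_nat_mult[symmetric] mult.commute)
  finally show ?thesis .
qed

text \<open>The rate condition is used twice: it makes the exponential at most
  \<open>1 / n ^ 2\<close>, and it bounds the number of cells, at most \<open>2 / b n\<close>, by a
  multiple of \<open>n\<close>. The product is therefore of order \<open>1 / n\<close>.\<close>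

lemma cells_times_exp_tendsto_0:
  fixes b :: "nat \<Rightarrow> real" and a :: real
  assumes pos: "\<And>n. n \<ge> 1 \<Longrightarrow> b n > 0" and lim: "b \<longlonglongrightarrow> 0"
    and rate: "(\<lambda>n. ln (real n) / (real n * b n)) \<longlonglongrightarrow> 0" and "a > 0"
  shows "(\<lambda>n. real (nat \<lceil>1 / b n\<rceil>) * exp (- a * n / real (nat \<lceil>1 / b n\<rceil>))) \<longlonglongrightarrow> 0"
proof (rule tendsto_sandwich[OF _ _ tendsto_const])
  show "(\<lambda>n. (a / 2) * inverse (real n)) \<longlonglongrightarrow> 0"
    by (intro tendsto_mult_right_zero lim_inverse_n)
  have "eventually (\<lambda>n. b n < 1) sequentially"
    using lim by (rule order_tendstoD) simp
  \<comment> \<open>The 4 is 2 times 2: one factor pays for rounding the number of cells up to at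
    most \<open>2 / b n\<close>, the other yields the exponent \<open>2 * ln n\<close>, so that one
    power of \<open>n\<close> survives multiplication by the number of cells.\<close>
  moreover have "eventually (\<lambda>n. ln (real n) / (real n * b n) < a / 4) sequentially"
    using rate by (rule order_tendstoD) (use \<open>a > 0\<close> in simp)
  ultimately show "eventually (\<lambda>n. real (nat \<lceil>1 / b n\<rceil>) * exp (- a * n / real (nat \<lceil>1 / b n\<rceil>))
      \<le> (a / 2) * inverse (real n)) sequentially"
    using eventually_ge_at_top[of 3]
  proof eventually_elim
    case (elim n)
    define m where "m = real (nat \<lceil>1 / b n\<rceil>)"
    have b: "b n > 0" "b n < 1" using pos elim by auto
    have "1 / b n > 1" using b by simp
    then have m: "1 / b n \<le> m" "m \<le> 1 / b n + 1" "m > 0"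
      unfolding m_def by linarith+
    then have m2: "m \<le> 2 / b n" using \<open>1 / b n > 1\<close> by linarith
    \<comment> \<open>This is where \<open>n \<ge> 3\<close> enters: \<open>ln n \<ge> 1\<close>
      later turns \<open>L\<close> into \<open>4 \<le> a * n * b n\<close>, the linear bound on the
      number of cells.\<close>
    have "exp 1 \<le> real n" using exp_le elim by linarith
    then have ln1: "ln (real n) \<ge> 1" using elim by (subst ln_ge_iff) auto
    have L: "4 * ln (real n) \<le> a * n * b n"
      using elim b by (simp add: field_simps)
    have "2 * ln (real n) \<le> a * n * (b n / 2)" using L by simp
    also have "\<dots> \<le> a * n * (1 / m)"
      using m2 m(3) b \<open>a > 0\<close> by (intro mult_left_mono) (auto simp: field_simps)
    finally have "exp (- a * n / m) \<le> exp (- (2 * ln (real n)))" by simp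
    also have "\<dots> = inverse (real n ^ 2)"
      using elim by (simp add: exp_minus exp_double)
    finally have "m * exp (- a * n / m) \<le> (2 / b n) * inverse (real n ^ 2)"
      using m m2 b by (intro mult_mono) auto
    also have "\<dots> \<le> (a * n / 2) * inverse (real n ^ 2)"
    proof (intro mult_right_mono)
      have "4 * 1 \<le> a * n * b n" using L ln1 by linarith
      then show "2 / b n \<le> a * n / 2" using b by (simp add: field_simps)
    qed simp
    also have "\<dots> = (a / 2) * inverse (real n)"
      using elim by (simp add: power2_eq_square field_simps)
    finally show ?case unfolding m_def .
  qed
qed simp

lemma unit_interval_cell:
  fixes x :: real
  assumes "m > 0" "x \<in> {0..1}"
  obtains k where "k < m" "x \<in> {real k / real m .. real (Suc k) / real m}"
proof (cases "x = 1")
  \<comment> \<open>At the right endpoint the floor of \<open>x * m\<close> would be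
    \<open>m\<close>, one past the last index; the last closed cell contains 1.\<close>
  case True
  with assms that[of "m - 1"] show ?thesis by auto
next
  case False
  define k where "k = nat \<lfloor>x * m\<rfloor>"
  have k: "real k \<le> x * m" "x * m < real k + 1"
    using assms unfolding k_def by auto
  have "x * m < m" using assms False by simp
  with k have "k < m" by (simp flip: of_nat_less_iff)
  moreover have "x \<in> {real k / real m .. real (Suc k) / real m}"
    using k assms by (auto simp: field_simps)
  ultimately show ?thesis by (rule that)
qed

text \<open>The deterministic part, for one fixed \<open>\<omega>\<close>. From above, every
  response in the window costs one modulus \<open>\<Delta>\<close>. From below, the hit in the cell
  of \<open>x\<close> costs \<open>\<Delta>\<close> for its noise and another
  \<open>\<Delta>\<close> for the modulus, whence the factor 2.\<close>

lemma h_tilde_close: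
  fixes h :: "real \<Rightarrow> real"
  assumes range: "\<And>i. i \<in> {1..n} \<Longrightarrow> X i \<omega> \<in> {0..1}"
    and below: "\<And>i. i \<in> {1..n} \<Longrightarrow> \<Lambda> (Y i \<omega>) \<le> h (X i \<omega>)"
    and modulus: "\<And>u v. u \<in> {0..1} \<Longrightarrow> v \<in> {0..1} \<Longrightarrow> \<bar>u - v\<bar> \<le> b n \<Longrightarrow> \<bar>h u - h v\<bar> \<le> \<Delta>"
    and m: "m > 0" "1 / real m \<le> b n"
    and hit: "\<And>k. k < m \<Longrightarrow> \<exists>i\<in>{1..n}. X i \<omega> \<in> {real k / m .. real (Suc k) / m} \<and>
        h (X i \<omega>) - \<Delta> < \<Lambda> (Y i \<omega>)"
    and x: "x \<in> {0..1}"
  shows "\<bar>h_tilde \<Lambda> X Y b n \<omega> x - h x\<bar> \<le> 2 * \<Delta>"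
proof -
  define I where "I = {i\<in>{1..n}. \<bar>X i \<omega> - x\<bar> \<le> b n}"
  have mod_x: "\<bar>h (X i \<omega>) - h x\<bar> \<le> \<Delta>" if "i \<in> I" for i
    using that range x by (intro modulus) (auto simp: I_def)
  obtain k where k: "k < m" "x \<in> {real k / real m .. real (Suc k) / real m}"
    using unit_interval_cell[OF m(1) x] .
  obtain i where i: "i \<in> {1..n}" "X i \<omega> \<in> {real k / m .. real (Suc k) / m}"
      "h (X i \<omega>) - \<Delta> < \<Lambda> (Y i \<omega>)"
    using hit[OF k(1)] by blast
  \<comment> \<open>A cell is no longer than \<open>b n\<close>, so the whole cell of
    \<open>x\<close> lies in the window around \<open>x\<close>.\<close>
  have "real (Suc k) / m - real k / m = 1 / m" by (simp add: add_divide_distrib)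
  then have "\<bar>X i \<omega> - x\<bar> \<le> b n"
    using k(2) i(2) m(2) unfolding atLeastAtMost_iff by linarith
  then have iI: "i \<in> I" using i(1) by (simp add: I_def)
  have fin: "finite I" by (simp add: I_def)
  \<comment> \<open>The hit makes the window nonempty, so the default value 0 does not
    occur.\<close>
  have eq: "h_tilde \<Lambda> X Y b n \<omega> x = Max ((\<lambda>i. \<Lambda> (Y i \<omega>)) ` I)"
    using iI unfolding h_tilde_def I_def[symmetric] Let_def by auto
  have "\<Lambda> (Y i \<omega>) \<le> h_tilde \<Lambda> X Y b n \<omega> x"
    unfolding eq using fin iI by simp
  moreover have "h_tilde \<Lambda> X Y b n \<omega> x \<le> h x + \<Delta>"
    unfolding eq
  proof (rule Max.boundedI)
    fix v assume "v \<in> (\<lambda>i. \<Lambda> (Y i \<omega>)) ` I"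
    then obtain j where j: "j \<in> I" "v = \<Lambda> (Y j \<omega>)" by blast
    have "\<Lambda> (Y j \<omega>) \<le> h (X j \<omega>)" using j(1) by (intro below) (simp add: I_def)
    with mod_x[OF j(1)] j(2) show "v \<le> h x + \<Delta>" by linarith
  qed (use fin iI in auto)
  ultimately show ?thesis
    using mod_x[OF iI] i(3) by linarith
qed

theorem lemma3p1:
  fixes M :: "'a measure"
    and X Y \<epsilon> :: "nat \<Rightarrow> 'a \<Rightarrow> real"
    and \<Lambda>0 h0 F0 F_X f_X :: "real \<Rightarrow> real"
    and b :: "nat \<Rightarrow> real"
  assumes prob: "prob_space M"
    and iid_XY: "\<And>n. prob_space.iid M (\<lambda>i \<omega>. (X i \<omega>, Y i \<omega>)) {1..n}"
    and model: "\<And>i. i \<ge> 1 \<Longrightarrow> AE \<omega> in M. \<Lambda>0 (Y i \<omega>) = h0 (X i \<omega>) + \<epsilon> i \<omega>"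
    and Lambda_mono: "strict_mono \<Lambda>0"
    and Lambda_cont: "continuous_on UNIV \<Lambda>0"
    and iid_eps: "\<And>n. prob_space.iid M \<epsilon> {1..n}"
    and cdf_eps: "\<And>i. i \<ge> 1 \<Longrightarrow> cdf (distr M borel (\<epsilon> i)) = F0"
    and F0_zero: "F0 0 = 1"
    and F0_neg: "\<And>\<Delta>. \<Delta> > 0 \<Longrightarrow> F0 (- \<Delta>) < 1"
    and indep_eps_X: "\<And>n. prob_space.indep_var M
          (\<Pi>\<^sub>M i\<in>{1..n}. borel) (\<lambda>\<omega>. \<lambda>i\<in>{1..n}. \<epsilon> i \<omega>)
          (\<Pi>\<^sub>M i\<in>{1..n}. borel) (\<lambda>\<omega>. \<lambda>i\<in>{1..n}. X i \<omega>)"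
    and iid_X: "\<And>n. prob_space.iid M X {1..n}"
    and cdf_X: "\<And>i. i \<ge> 1 \<Longrightarrow> cdf (distr M borel (X i)) = F_X"
    and density_X: "\<And>i. i \<ge> 1 \<Longrightarrow> distributed M lborel (X i) (\<lambda>x. ennreal (f_X x))"
    and f_X_nonneg: "\<And>x. f_X x \<ge> 0"
    and f_X_support: "closure {x. f_X x \<noteq> 0} = {0..1}"
    and f_X_cont: "continuous_on {0..1} f_X"
    and f_X_away: "\<exists>c>0. \<forall>x\<in>{0..1}. f_X x \<ge> c"
    and h0_cont: "continuous_on {0..1} h0"
    and b_pos: "\<And>n. n \<ge> 1 \<Longrightarrow> b n > 0"
    and b_lim: "b \<longlonglongrightarrow> 0"
    and b_rate: "(\<lambda>n. ln (real n) / (real n * b n)) \<longlonglongrightarrow> 0"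
  shows "prob_space.little_o_P_1 M
           (\<lambda>n \<omega>. SUP x\<in>{0..1}. \<bar>h_tilde \<Lambda>0 X Y b n \<omega> x - h0 x\<bar>)"
proof -
  interpret prob_space M by (rule prob)
  obtain c where c: "c > 0" "\<And>x. x \<in> {0..1} \<Longrightarrow> c \<le> f_X x"
    using f_X_away by blast
  have [measurable]: "random_variable borel (X i)" if "i \<ge> 1" for i
    using distributed_measurable[OF density_X[OF that]] by simp
  have rv_XY: "random_variable borel (\<lambda>\<omega>. (X i \<omega>, Y i \<omega>))" if "i \<ge> 1" for i
    using iid_XY[of i] that unfolding iid_def indep_vars_def by auto
  have [measurable]: "random_variable borel (\<epsilon> i)" if "i \<ge> 1" for i
    using iid_eps[of i] that unfolding iid_def indep_vars_def by auto

  have eps_le: "prob {\<omega>\<in>space M. \<epsilon> i \<omega> \<le> t} = F0 t" if "i \<ge> 1" for i t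
    using fun_cong[OF cdf_eps[OF that], of t] that
    by (simp add: cdf_def measure_distr vimage_def Int_def conj_commute)
  have AE_X: "AE \<omega> in M. X i \<omega> \<in> {0..1}" if "i \<ge> 1" for i
  proof -
    have "x \<in> {0..1}" if "f_X x > 0" for x
      using closure_subset[of "{x. f_X x \<noteq> 0}"] f_X_support that by force
    then show ?thesis
      using distributed_AE2[OF density_X[OF that], of "\<lambda>x. x \<in> {0..1}"] by auto
  qed
  have AE_eps: "AE \<omega> in M. \<epsilon> i \<omega> \<le> 0" if "i \<ge> 1" for i
    using that eps_le[OF that, of 0] F0_zero by (subst prob_Collect_eq_1[symmetric]) auto
  \<comment> \<open>Quantifying over all \<open>i\<close> inside the almost-sure statement gives one
    null set that serves every sample size.\<close>
  have AE_good: "AE \<omega> in M. \<forall>i. i \<ge> 1 \<longrightarrow> X i \<omega> \<in> {0..1} \<and> \<Lambda>0 (Y i \<omega>) \<le> h0 (X i \<omega>)"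
    unfolding AE_all_countable
  proof (intro allI)
    fix i
    show "AE \<omega> in M. i \<ge> 1 \<longrightarrow> X i \<omega> \<in> {0..1} \<and> \<Lambda>0 (Y i \<omega>) \<le> h0 (X i \<omega>)"
    proof (cases "i \<ge> 1")
      case True
      from AE_X[OF this] AE_eps[OF this] model[OF this] show ?thesis by eventually_elim auto
    qed simp
  qed

  have prob_joint: "prob {\<omega>\<in>space M. X i \<omega> \<in> A \<and> \<epsilon> i \<omega> \<in> B} =
      prob {\<omega>\<in>space M. X i \<omega> \<in> A} * prob {\<omega>\<in>space M. \<epsilon> i \<omega> \<in> B}"
    if "i \<ge> 1" "A \<in> sets borel" "B \<in> sets borel" for i A B
  proof -
    \<comment> \<open>Independence is assumed for the whole vectors; projecting those of length
      \<open>i\<close> to their last coordinate gives it for the single pair.\<close>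
    have "indep_var borel ((\<lambda>f. f i) \<circ> (\<lambda>\<omega>. \<lambda>i\<in>{1..i}. \<epsilon> i \<omega>))
        borel ((\<lambda>f. f i) \<circ> (\<lambda>\<omega>. \<lambda>i\<in>{1..i}. X i \<omega>))"
      using that by (intro indep_var_compose[OF indep_eps_X[of i]] measurable_component_singleton) auto
    then have "indep_var borel (\<epsilon> i) borel (X i)"
      using that by (simp add: comp_def)
    from indep_varD[OF this that(3,2)] show ?thesis
      by (simp add: vimage_def Int_def conj_commute mult.commute)
  qed

  \<comment> \<open>\<open>h0\<close> is only known to be measurable on \<open>[0,1]\<close>, so events are written with this continuous extension.\<close>
  define g where "g = (\<lambda>x. h0 (max 0 (min 1 x)))"
  have g_cont: "continuous_on UNIV g"
    unfolding g_def by (intro continuous_on_compose2[OF h0_cont] continuous_intros) auto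
  have g_eq: "g x = h0 x" if "x \<in> {0..1}" for x
    using that by (simp add: g_def)
  \<comment> \<open>The noise condition is phrased through the pair \<open>(X i, Y i)\<close>, so
    that the independence in \<open>iid_XY\<close> applies directly. By the model, the second
    conjunct almost surely means \<open>\<epsilon> i > - \<Delta>\<close>.\<close>
  define S where "S = (\<lambda>m k \<Delta>. {z :: real \<times> real.
      fst z \<in> {real k / real m .. real (Suc k) / real m} \<and> g (fst z) - \<Delta> < \<Lambda>0 (snd z)})"
  have S_borel: "S m k \<Delta> \<in> sets borel" for m k \<Delta>
  proof -
    have "S m k \<Delta> = ({real k / real m .. real (Suc k) / real m} \<times> UNIV) \<inter>
        {z. g (fst z) - \<Delta> < \<Lambda>0 (snd z)}"
      by (auto simp: S_def)
    moreover have "open {z :: real \<times> real. g (fst z) - \<Delta> < \<Lambda>0 (snd z)}"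
      by (intro open_Collect_less continuous_intros
          continuous_on_compose2[OF g_cont] continuous_on_compose2[OF Lambda_cont]) auto
    ultimately show ?thesis
      by (simp only: sets.Int borel_open borel_closed closed_Times closed_atLeastAtMost closed_UNIV)
  qed

  \<comment> \<open>The design point falls in a cell of length \<open>1 / m\<close> with probability
    at least \<open>c / m\<close>, and independently the noise exceeds \<open>- \<Delta>\<close>
    with probability \<open>1 - F0 (- \<Delta>)\<close>.\<close>
  have prob_S: "c * (1 - F0 (- \<Delta>)) / m \<le> prob {\<omega>\<in>space M. (X i \<omega>, Y i \<omega>) \<in> S m k \<Delta>}"
    if i: "i \<ge> 1" and k: "k < m" and "\<Delta> > 0" for i m k \<Delta>
  proof -
    let ?A = "{real k / real m .. real (Suc k) / real m}"
    have len: "real (Suc k) / m - real k / m = 1 / m" by (simp add: add_divide_distrib)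
    have A_sub: "?A \<subseteq> {0..1}"
    proof
      fix x assume x: "x \<in> ?A"
      have "0 \<le> real k / m" "real (Suc k) / m \<le> 1" using k by auto
      with x show "x \<in> {0..1}" unfolding atLeastAtMost_iff by linarith
    qed
    have "ennreal (c / m) = ennreal c * emeasure lborel ?A"
      using c k len by (subst emeasure_lborel_Icc) (auto simp: ennreal_mult[symmetric] divide_right_mono)
    also have "\<dots> = (\<integral>\<^sup>+x. ennreal c * indicator ?A x \<partial>lborel)"
      by (simp add: nn_integral_cmult_indicator)
    also have "\<dots> \<le> (\<integral>\<^sup>+x. ennreal (f_X x) * indicator ?A x \<partial>lborel)"
      using c(2)[OF subsetD[OF A_sub]]
      by (intro nn_integral_mono) (auto split: split_indicator intro: ennreal_leI)
    also have "\<dots> = emeasure M (X i -` ?A \<inter> space M)"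
      by (rule distributed_emeasure[OF density_X[OF i], symmetric]) simp
    also have "\<dots> = ennreal (prob {\<omega>\<in>space M. X i \<omega> \<in> ?A})"
      by (simp add: emeasure_eq_measure vimage_def Int_def conj_commute)
    finally have pX: "c / m \<le> prob {\<omega>\<in>space M. X i \<omega> \<in> ?A}" by simp
    have "{\<omega>\<in>space M. \<epsilon> i \<omega> \<in> {- \<Delta><..}} = space M - {\<omega>\<in>space M. \<epsilon> i \<omega> \<le> - \<Delta>}"
      by auto
    moreover have "{\<omega>\<in>space M. \<epsilon> i \<omega> \<le> - \<Delta>} \<in> events" using i by measurable
    ultimately have pe: "prob {\<omega>\<in>space M. \<epsilon> i \<omega> \<in> {- \<Delta><..}} = 1 - F0 (- \<Delta>)"
      using eps_le[OF i] by (simp add: prob_compl)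
    have "c * (1 - F0 (- \<Delta>)) / m \<le>
        prob {\<omega>\<in>space M. X i \<omega> \<in> ?A} * prob {\<omega>\<in>space M. \<epsilon> i \<omega> \<in> {- \<Delta><..}}"
      using mult_right_mono[OF pX, of "1 - F0 (- \<Delta>)"] F0_neg[OF \<open>\<Delta> > 0\<close>] unfolding pe by simp
    also have "\<dots> = prob {\<omega>\<in>space M. X i \<omega> \<in> ?A \<and> \<epsilon> i \<omega> \<in> {- \<Delta><..}}"
      using i by (intro prob_joint[symmetric]) auto
    \<comment> \<open>The two events agree only up to a null set, since the model equation and
      \<open>X i \<omega> \<in> {0..1}\<close> hold almost surely.\<close>
    also have "\<dots> = prob {\<omega>\<in>space M. (X i \<omega>, Y i \<omega>) \<in> S m k \<Delta>}"
    proof (rule finite_measure_eq_AE)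
      show "AE \<omega> in M. \<omega> \<in> {\<omega>\<in>space M. X i \<omega> \<in> ?A \<and> \<epsilon> i \<omega> \<in> {- \<Delta><..}} \<longleftrightarrow>
          \<omega> \<in> {\<omega>\<in>space M. (X i \<omega>, Y i \<omega>) \<in> S m k \<Delta>}"
        using model[OF i] AE_X[OF i] by eventually_elim (auto simp: S_def g_eq)
      show "{\<omega>\<in>space M. X i \<omega> \<in> ?A \<and> \<epsilon> i \<omega> \<in> {- \<Delta><..}} \<in> events"
        using i by measurable
      show "{\<omega>\<in>space M. (X i \<omega>, Y i \<omega>) \<in> S m k \<Delta>} \<in> events"
        using measurable_sets[OF rv_XY[OF i] S_borel]
        by (simp add: vimage_def Int_def conj_commute)
    qed
    finally show ?thesis .
  qed

  show ?thesis
    unfolding little_o_P_1_def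
  proof (intro allI impI)
    fix e :: real assume "e > 0"
    \<comment> \<open>Chosen so that the error \<open>2 * \<Delta>\<close> of
      \<open>h_tilde_close\<close> is exactly \<open>e\<close>, which the strict inequality in the
      event excludes.\<close>
    define \<Delta> where "\<Delta> = e / 2"
    have "\<Delta> > 0" using \<open>e > 0\<close> by (simp add: \<Delta>_def)
    define a where "a = c * (1 - F0 (- \<Delta>))"
    have "a > 0" using c F0_neg[OF \<open>\<Delta> > 0\<close>] by (simp add: a_def)
    define m where "m = (\<lambda>n. nat \<lceil>1 / b n\<rceil>)"
    define bad where "bad = (\<lambda>n k. {\<omega>\<in>space M. \<forall>i\<in>{1..n}. (X i \<omega>, Y i \<omega>) \<notin> S (m n) k \<Delta>})"
    have "uniformly_continuous_on {0..1} h0"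
      using h0_cont by (intro compact_uniformly_continuous) auto
    then obtain \<delta> where \<delta>: "\<delta> > 0"
        "\<And>u v. u \<in> {0..1} \<Longrightarrow> v \<in> {0..1} \<Longrightarrow> \<bar>u - v\<bar> < \<delta> \<Longrightarrow> \<bar>h0 u - h0 v\<bar> < \<Delta>"
      using \<open>\<Delta> > 0\<close> unfolding uniformly_continuous_on_def dist_real_def by metis
    obtain N where N: "{\<omega>\<in>space M. \<not> (\<forall>i. i \<ge> 1 \<longrightarrow> X i \<omega> \<in> {0..1} \<and> \<Lambda>0 (Y i \<omega>) \<le> h0 (X i \<omega>))} \<subseteq> N"
        "emeasure M N = 0" "N \<in> events"
      using AE_good by (rule AE_E)

    have bound: "outer_measure_of M {\<omega>\<in>space M. \<bar>SUP x\<in>{0..1}. \<bar>h_tilde \<Lambda>0 X Y b n \<omega> x - h0 x\<bar>\<bar> > e}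
        \<le> ennreal (real (m n) * exp (- a * n / real (m n)))"
      if n: "n \<ge> 1" and bn: "b n < \<delta>" for n
    proof -
      have "b n > 0" using b_pos n .
      have "1 / b n > 0" using \<open>b n > 0\<close> by simp
      then have m: "1 / b n \<le> m n" "m n > 0" unfolding m_def by linarith+
      have mb: "1 / m n \<le> b n" using m \<open>b n > 0\<close> by (simp add: field_simps)
      have "{\<omega>\<in>space M. (X i \<omega>, Y i \<omega>) \<in> S (m n) k \<Delta>} \<in> events" if "i \<in> {1..n}" for i k
        using measurable_sets[OF rv_XY S_borel] that
        by (simp add: vimage_def Int_def conj_commute)
      then have bad_events: "bad n k \<in> events" for k
        unfolding bad_def by (intro sets.sets_Collect_finite_All) (auto intro: sets.sets_Collect_neg)
      have bad_prob: "prob (bad n k) \<le> exp (- a * n / real (m n))" if "k < m n" for k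
        using prob_all_avoid_le_exp[of "\<lambda>_. borel" "\<lambda>i \<omega>. (X i \<omega>, Y i \<omega>)" "{1..n}"
            "\<lambda>_. S (m n) k \<Delta>" "a / real (m n)"]
          iid_XY[of n] S_borel prob_S[OF _ that \<open>\<Delta> > 0\<close>]
        unfolding bad_def a_def iid_def by auto
      \<comment> \<open>The event for the supremum is not known to be measurable, so it is covered
        by measurable sets: off the null set \<open>N\<close> and off every \<open>bad n k\<close>,
        the hypotheses of \<open>h_tilde_close\<close> hold.\<close>
      have "{\<omega>\<in>space M. \<bar>SUP x\<in>{0..1}. \<bar>h_tilde \<Lambda>0 X Y b n \<omega> x - h0 x\<bar>\<bar> > e}
          \<subseteq> N \<union> (\<Union>k<m n. bad n k)"
      proof (intro subsetI, rule ccontr)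
        fix \<omega> assume \<omega>: "\<omega> \<in> {\<omega>\<in>space M. \<bar>SUP x\<in>{0..1}. \<bar>h_tilde \<Lambda>0 X Y b n \<omega> x - h0 x\<bar>\<bar> > e}"
          and out: "\<omega> \<notin> N \<union> (\<Union>k<m n. bad n k)"
        have good: "X i \<omega> \<in> {0..1}" "\<Lambda>0 (Y i \<omega>) \<le> h0 (X i \<omega>)" if "i \<in> {1..n}" for i
          using N(1) \<omega> out that by auto
        have le: "\<bar>h_tilde \<Lambda>0 X Y b n \<omega> x - h0 x\<bar> \<le> e" if "x \<in> {0..1}" for x
        proof -
          have "\<bar>h_tilde \<Lambda>0 X Y b n \<omega> x - h0 x\<bar> \<le> 2 * \<Delta>"
          proof (rule h_tilde_close[where n = n and m = "m n"])
            fix u v :: real assume "u \<in> {0..1}" "v \<in> {0..1}" "\<bar>u - v\<bar> \<le> b n"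
            then show "\<bar>h0 u - h0 v\<bar> \<le> \<Delta>" using \<delta>(2)[of u v] bn by linarith
          next
            fix k assume "k < m n"
            then obtain i where i: "i \<in> {1..n}" "(X i \<omega>, Y i \<omega>) \<in> S (m n) k \<Delta>"
              using out \<omega> unfolding bad_def by blast
            then show "\<exists>i\<in>{1..n}. X i \<omega> \<in> {real k / m n .. real (Suc k) / m n} \<and>
                h0 (X i \<omega>) - \<Delta> < \<Lambda>0 (Y i \<omega>)"
              using g_eq[OF good(1)[OF i(1)]] by (intro bexI[of _ i]) (simp_all add: S_def)
          qed (fact good m(2) mb that)+
          then show ?thesis by (simp add: \<Delta>_def)
        qed
        \<comment> \<open>The bound \<open>le\<close> is uniform in \<open>x\<close>, so it also
          makes the real supremum one of a bounded set.\<close>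
        have "\<bar>SUP x\<in>{0..1}. \<bar>h_tilde \<Lambda>0 X Y b n \<omega> x - h0 x\<bar>\<bar> \<le> e"
          using le by (intro cSup_abs_le) auto
        with \<omega> show False by auto
      qed
      then have "outer_measure_of M {\<omega>\<in>space M. \<bar>SUP x\<in>{0..1}. \<bar>h_tilde \<Lambda>0 X Y b n \<omega> x - h0 x\<bar>\<bar> > e}
          \<le> outer_measure_of M (N \<union> (\<Union>k<m n. bad n k))"
        by (rule outer_measure_of_mono)
      also have "\<dots> = emeasure M (N \<union> (\<Union>k<m n. bad n k))"
        using N(3) bad_events by (intro outer_measure_of_eq) auto
      also have "\<dots> \<le> emeasure M N + emeasure M (\<Union>k<m n. bad n k)"
        using N(3) bad_events by (intro emeasure_subadditive) auto
      also have "\<dots> = ennreal (prob (\<Union>k<m n. bad n k))"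
        using N(2) by (simp add: emeasure_eq_measure)
      also have "\<dots> \<le> ennreal (\<Sum>k<m n. prob (bad n k))"
        using bad_events by (intro ennreal_leI finite_measure_subadditive_finite) auto
      also have "\<dots> \<le> ennreal (real (m n) * exp (- a * n / real (m n)))"
        using sum_mono[of "{..<m n}" "\<lambda>k. prob (bad n k)" "\<lambda>_. exp (- a * n / real (m n))"] bad_prob
        by (intro ennreal_leI) simp
      finally show ?thesis .
    qed

    have upper_lim: "(\<lambda>n. ennreal (real (m n) * exp (- a * n / real (m n)))) \<longlonglongrightarrow> 0"
      unfolding m_def ennreal_0[symmetric]
      using cells_times_exp_tendsto_0[OF b_pos b_lim b_rate \<open>a > 0\<close>] by (rule tendsto_ennrealI)
    have upper: "eventually (\<lambda>n. outer_measure_of M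
        {\<omega>\<in>space M. \<bar>SUP x\<in>{0..1}. \<bar>h_tilde \<Lambda>0 X Y b n \<omega> x - h0 x\<bar>\<bar> > e}
        \<le> ennreal (real (m n) * exp (- a * n / real (m n)))) sequentially"
      using eventually_ge_at_top[of 1] order_tendstoD(2)[OF b_lim \<delta>(1)]
      by eventually_elim (rule bound)
    show "(\<lambda>n. outer_measure_of M
        {\<omega>\<in>space M. \<bar>SUP x\<in>{0..1}. \<bar>h_tilde \<Lambda>0 X Y b n \<omega> x - h0 x\<bar>\<bar> > e}) \<longlonglongrightarrow> 0"
      by (rule tendsto_sandwich[OF always_eventually upper tendsto_const upper_lim]) simp
  qed
qed

end
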